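(* Let $R$ be an effective commutative ring with unity, let $d\ge 1$, let $c_0,\dots,c_{d-1}\in R$ and $u_0,\dots,u_{d-1}\in R$, and let $(u_n)_{n\ge 0}$ be the linearly recurrent sequence of order $d$ with these initial terms defined by $$u_{n+d}=c_{d-1}u_{n+d-1}+\dots+c_0u_n,\qquad n\ge 0.$$ Given $c_0,\dots,c_{d-1}$, $u_0,\dots,u_{d-1}$ and a positive integer $N$, one can compute the term $u_N$ using $$\mathsf{T}(N,d)=2\,\mathsf{M}(d)\,\lceil \log(N+1)\rceil+\mathsf{M}(d)$$ arithmetic operations in $R$.
   Context: A ring $R$ (commutative with unity) is called effective if its elements are represented by some data structure and there are algorithms for performing the ring operations $(+,-,\times)$ and for testing equality. Complexity is measured in the algebraic model: one counts arithmetic operations in $R$. $\mathsf{M}(d)$ denotes the arithmetic cost of polynomial multiplication in $R[x]$ in degree $d$, i.e. the number of arithmetic operations in $R$ used for computing the product of two polynomials of degree (at most) $d$. The notation $\log$ refers to the logarithm in base $2$. *)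

theory Defs
  imports Complex_Main "HOL-Computational_Algebra.Polynomial"
begin

text \<open>
  The algebraic model of computation: straight-line programs over a commutative ring.
  The memory initially holds the input; every instruction performs one ring operation and
  appends its result to the memory. Copying, rewiring and reading constants of the ring are
  free. Negation is the subtraction from 0, so it is counted.
\<close>

datatype 'a operand = Const 'a | Reg nat

datatype 'a instr =
    Add "'a operand" "'a operand"
  | Sub "'a operand" "'a operand"
  | Mul "'a operand" "'a operand"

datatype 'a slp = Slp (slp_instrs: "'a instr list") (slp_outputs: "'a operand list")

text \<open>A cell that has not been written yet reads as 0, so every program is meaningful.\<close>

fun operand_val :: "'a::comm_ring_1 list \<Rightarrow> 'a operand \<Rightarrow> 'a" where
  "operand_val mem (Const a) = a"
| "operand_val mem (Reg i) = (if i < length mem then mem ! i else 0)"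

fun instr_val :: "'a::comm_ring_1 list \<Rightarrow> 'a instr \<Rightarrow> 'a" where
  "instr_val mem (Add x y) = operand_val mem x + operand_val mem y"
| "instr_val mem (Sub x y) = operand_val mem x - operand_val mem y"
| "instr_val mem (Mul x y) = operand_val mem x * operand_val mem y"

fun exec_instrs :: "'a::comm_ring_1 instr list \<Rightarrow> 'a list \<Rightarrow> 'a list" where
  "exec_instrs [] mem = mem"
| "exec_instrs (i # is) mem = exec_instrs is (mem @ [instr_val mem i])"

definition slp_run :: "'a::comm_ring_1 slp \<Rightarrow> 'a list \<Rightarrow> 'a list" where
  "slp_run p xs = map (operand_val (exec_instrs (slp_instrs p) xs)) (slp_outputs p)"

definition slp_cost :: "'a slp \<Rightarrow> nat" where
  "slp_cost p = length (slp_instrs p)"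

definition multiplies_polys :: "nat \<Rightarrow> 'a::comm_ring_1 slp \<Rightarrow> bool" where
  "multiplies_polys d p \<longleftrightarrow>
     (\<forall>f g :: 'a poly. degree f \<le> d \<longrightarrow> degree g \<le> d \<longrightarrow>
        slp_run p (map (coeff f) [0..<d + 1] @ map (coeff g) [0..<d + 1])
          = map (coeff (f * g)) [0..<2 * d + 1])"

definition linear_recurrent :: "nat \<Rightarrow> (nat \<Rightarrow> 'a::comm_ring_1) \<Rightarrow> (nat \<Rightarrow> 'a) \<Rightarrow> bool" where
  "linear_recurrent d c u \<longleftrightarrow> (\<forall>n. u (n + d) = (\<Sum>i<d. c i * u (n + i)))"

text \<open>The program may depend on the index N and the order d, but not on the ring elements.\<close>

definition computes_term :: "nat \<Rightarrow> nat \<Rightarrow> 'a::comm_ring_1 slp \<Rightarrow> bool" where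
  "computes_term d N p \<longleftrightarrow>
     (\<forall>c u :: nat \<Rightarrow> 'a. linear_recurrent d c u \<longrightarrow>
        slp_run p (map c [0..<d] @ map u [0..<d]) = [u N])"

end

(*
  With Q(x) = 1 - c_{d-1} x - ... - c_0 x^d the generating function of u is P/Q, where P is
  Q * (u_0 + ... + u_{d-1} x^{d-1}) truncated below degree d.  Writing
  P/Q = P(x) Q(-x) / (Q(x) Q(-x)), whose denominator is a polynomial in x^2, the coefficient of x^N
  of P/Q becomes the coefficient of x^(N div 2) of a fraction of the same shape, at the cost of two
  products; this is repeated once per binary digit of N.

  The negations in Q and Q(-x) are charged in this model, so they must be avoided: every
  quantity is kept only up to a sign that does not depend on the input, which makes negation free
  and does not change the cost of additions and multiplications.  The last round needs no
  new denominator, and the product thus saved pays for correcting the sign of the result.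
*)

theory Submission
  imports Defs "HOL-Computational_Algebra.Polynomial_FPS"
begin

section \<open>Simulating straight-line programs on quantities known up to sign\<close>

section \<open>Programs whose cells are known up to sign\<close>

lemma exec_instrs_append: "exec_instrs (is @ js) mem = exec_instrs js (exec_instrs is mem)"
  by (induction "is" arbitrary: mem) auto

lemma length_exec_instrs: "length (exec_instrs is mem) = length mem + length is"
  by (induction "is" arbitrary: mem) auto

lemma exec_instrs_prefix: "\<exists>zs. exec_instrs is mem = mem @ zs"
  by (induction "is" arbitrary: mem) (auto simp: append_assoc, metis append_assoc)

fun operand_below :: "nat \<Rightarrow> 'a operand \<Rightarrow> bool" where
  "operand_below n (Const a) \<longleftrightarrow> True"
| "operand_below n (Reg i) \<longleftrightarrow> i < n"

lemma operand_val_append: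
  "operand_below (length mem) x \<Longrightarrow> operand_val (mem @ zs) x = operand_val mem x"
  by (cases x) (auto simp: nth_append)

lemma operand_below_mono: "operand_below m x \<Longrightarrow> m \<le> n \<Longrightarrow> operand_below n x"
  by (cases x) auto

text \<open>\<open>D\<close> is the set of all problem instances and \<open>inp v\<close> the
  initial memory for instance \<open>v\<close>. Quantities are functions of the instance, so that
  one program has to serve them all.\<close>

locale program_inputs =
  fixes D :: "'i set" and inp :: "'i \<Rightarrow> 'a::comm_ring_1 list" and n :: nat
  assumes length_inp: "v \<in> D \<Longrightarrow> length (inp v) = n"
begin

text \<open>The sign is fixed before the instance: each disjunct quantifies over all of
  \<open>D\<close>, so later instructions can be adapted to it. The bound on \<open>x\<close>
  excludes unwritten cells, whose default value 0 could change as the program grows.\<close>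

definition cells :: "'a instr list \<Rightarrow> ('i \<Rightarrow> 'a) set" where
  "cells is = {f. \<exists>x. operand_below (n + length is) x \<and>
     ((\<forall>v\<in>D. f v = operand_val (exec_instrs is (inp v)) x) \<or>
      (\<forall>v\<in>D. f v = - operand_val (exec_instrs is (inp v)) x))}"

lemma cellsI:
  assumes "operand_below (n + length is) x"
    and "\<And>v. v \<in> D \<Longrightarrow> f v = operand_val (exec_instrs is (inp v)) x"
  shows "f \<in> cells is"
  using assms unfolding cells_def by blast

lemma cells_cong: "f \<in> cells is \<Longrightarrow> (\<And>v. v \<in> D \<Longrightarrow> g v = f v) \<Longrightarrow> g \<in> cells is"
  unfolding cells_def by simp

lemma cells_const: "(\<lambda>v. a) \<in> cells is"
  by (rule cellsI[where x = "Const a"]) auto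

lemma cells_uminus: "f \<in> cells is \<Longrightarrow> (\<lambda>v. - f v) \<in> cells is"
  unfolding cells_def by force

lemma cells_append: "cells is \<subseteq> cells (is @ js)"
proof
  fix f assume "f \<in> cells is"
  then obtain x where x: "operand_below (n + length is) x"
    "(\<forall>v\<in>D. f v = operand_val (exec_instrs is (inp v)) x) \<or>
     (\<forall>v\<in>D. f v = - operand_val (exec_instrs is (inp v)) x)"
    unfolding cells_def by blast
  have "operand_val (exec_instrs (is @ js) (inp v)) x = operand_val (exec_instrs is (inp v)) x"
    if "v \<in> D" for v
  proof -
    obtain zs where "exec_instrs js (exec_instrs is (inp v)) = exec_instrs is (inp v) @ zs"
      using exec_instrs_prefix by blast
    then show ?thesis
      using x(1) that by (simp add: exec_instrs_append length_exec_instrs length_inp operand_val_append)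
  qed
  moreover have "operand_below (n + length (is @ js)) x"
    using x(1) by (rule operand_below_mono) simp
  ultimately show "f \<in> cells (is @ js)"
    using x(2) unfolding cells_def by auto
qed

lemma cells_instr:
  assumes "\<And>v. v \<in> D \<Longrightarrow> f v = instr_val (exec_instrs is (inp v)) i"
  shows "f \<in> cells (is @ [i])"
  by (rule cellsI[where x = "Reg (n + length is)"])
    (use assms in \<open>auto simp: exec_instrs_append length_exec_instrs length_inp nth_append\<close>)

text \<open>One instruction suffices for each sign pattern: opposite signs turn the addition into a
  subtraction in the right order, and two minus signs are carried over to the sum.\<close>

lemma cells_add:
  assumes "f \<in> cells is" "g \<in> cells is"
  shows "\<exists>i. (\<lambda>v. f v + g v) \<in> cells (is @ [i])"
proof -
  let ?val = "\<lambda>v. operand_val (exec_instrs is (inp v))"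
  obtain x y where
    x: "(\<forall>v\<in>D. f v = ?val v x) \<or> (\<forall>v\<in>D. f v = - ?val v x)" and
    y: "(\<forall>v\<in>D. g v = ?val v y) \<or> (\<forall>v\<in>D. g v = - ?val v y)"
    using assms unfolding cells_def by blast
  from x y consider
      "\<forall>v\<in>D. f v + g v = ?val v x + ?val v y"
    | "\<forall>v\<in>D. f v + g v = ?val v x - ?val v y"
    | "\<forall>v\<in>D. f v + g v = ?val v y - ?val v x"
    | "\<forall>v\<in>D. f v + g v = - (?val v x + ?val v y)"
    by fastforce
  then show ?thesis
  proof cases
    case 1
    then have "(\<lambda>v. f v + g v) \<in> cells (is @ [Add x y])" by (intro cells_instr) auto
    then show ?thesis ..
  next
    case 2
    then have "(\<lambda>v. f v + g v) \<in> cells (is @ [Sub x y])" by (intro cells_instr) auto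
    then show ?thesis ..
  next
    case 3
    then have "(\<lambda>v. f v + g v) \<in> cells (is @ [Sub y x])" by (intro cells_instr) auto
    then show ?thesis ..
  next
    case 4
    then have "(\<lambda>v. - (f v + g v)) \<in> cells (is @ [Add x y])" by (intro cells_instr) auto
    from cells_uminus[OF this] have "(\<lambda>v. f v + g v) \<in> cells (is @ [Add x y])" by (simp add: add.commute)
    then show ?thesis ..
  qed
qed

lemma cells_mult:
  assumes "f \<in> cells is" "g \<in> cells is"
  shows "\<exists>i. (\<lambda>v. f v * g v) \<in> cells (is @ [i])"
proof -
  let ?val = "\<lambda>v. operand_val (exec_instrs is (inp v))"
  obtain x y where
    x: "(\<forall>v\<in>D. f v = ?val v x) \<or> (\<forall>v\<in>D. f v = - ?val v x)" and
    y: "(\<forall>v\<in>D. g v = ?val v y) \<or> (\<forall>v\<in>D. g v = - ?val v y)"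
    using assms unfolding cells_def by blast
  from x y consider
      "\<forall>v\<in>D. f v * g v = ?val v x * ?val v y"
    | "\<forall>v\<in>D. f v * g v = - (?val v x * ?val v y)"
    by fastforce
  then show ?thesis
  proof cases
    case 1
    then have "(\<lambda>v. f v * g v) \<in> cells (is @ [Mul x y])" by (intro cells_instr) auto
    then show ?thesis ..
  next
    case 2
    then have "(\<lambda>v. - (f v * g v)) \<in> cells (is @ [Mul x y])" by (intro cells_instr) auto
    from cells_uminus[OF this] have "(\<lambda>v. f v * g v) \<in> cells (is @ [Mul x y])" by simp
    then show ?thesis ..
  qed
qed

lemma cells_operand_val:
  assumes "set fs \<subseteq> cells is"
  shows "(\<lambda>v. operand_val (map (\<lambda>f. f v) fs) x) \<in> cells is"
proof (cases x)
  case (Reg i)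
  then show ?thesis
    using assms cells_const by (cases "i < length fs") auto
qed (simp add: cells_const)

lemma cells_instr_val:
  assumes "set fs \<subseteq> cells is"
  shows "\<exists>j. (\<lambda>v. instr_val (map (\<lambda>f. f v) fs) i) \<in> cells (is @ [j])"
proof (cases i)
  case (Add x y)
  then show ?thesis
    using cells_add[OF cells_operand_val[OF assms] cells_operand_val[OF assms]] by simp
next
  case (Sub x y)
  then show ?thesis
    using cells_add[OF cells_operand_val[OF assms] cells_uminus[OF cells_operand_val[OF assms]]]
    by simp
next
  case (Mul x y)
  then show ?thesis
    using cells_mult[OF cells_operand_val[OF assms] cells_operand_val[OF assms]] by simp
qed

text \<open>Inlines \<open>ps\<close> on arguments known only up to sign. The new instructions
  \<open>js\<close> may differ from \<open>ps\<close> (an \<open>Add\<close> may become a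
  \<open>Sub\<close>), but there are equally many.\<close>

lemma cells_exec_instrs:
  assumes "set fs \<subseteq> cells is"
  shows "\<exists>js gs. length js = length ps \<and> set gs \<subseteq> cells (is @ js) \<and>
    (\<forall>v. exec_instrs ps (map (\<lambda>f. f v) fs) = map (\<lambda>g. g v) gs)"
  using assms
proof (induction ps arbitrary: fs "is")
  case Nil
  then show ?case by (intro exI[of _ "[]"] exI[of _ fs]) auto
next
  case (Cons p ps)
  let ?f = "\<lambda>v. instr_val (map (\<lambda>f. f v) fs) p"
  obtain j where "?f \<in> cells (is @ [j])"
    using cells_instr_val[OF Cons.prems] by blast
  then have "set (fs @ [?f]) \<subseteq> cells (is @ [j])"
    using Cons.prems cells_append by auto
  from Cons.IH[OF this] obtain js gs where "length js = length ps"
    "set gs \<subseteq> cells ((is @ [j]) @ js)"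
    "\<forall>v. exec_instrs ps (map (\<lambda>f. f v) (fs @ [?f])) = map (\<lambda>g. g v) gs"
    by blast
  then show ?case
    by (intro exI[of _ "j # js"] exI[of _ gs]) auto
qed

lemma cells_slp_run:
  assumes "set fs \<subseteq> cells is"
  shows "\<exists>js. length js = slp_cost p \<and>
    (\<forall>k < length (slp_outputs p). (\<lambda>v. slp_run p (map (\<lambda>f. f v) fs) ! k) \<in> cells (is @ js))"
proof -
  obtain js gs where js: "length js = length (slp_instrs p)" "set gs \<subseteq> cells (is @ js)"
    "\<forall>v. exec_instrs (slp_instrs p) (map (\<lambda>f. f v) fs) = map (\<lambda>g. g v) gs"
    using cells_exec_instrs[OF assms] by blast
  then show ?thesis
    using cells_operand_val[OF js(2)] by (intro exI[of _ js]) (auto simp: slp_cost_def slp_run_def)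
qed

text \<open>The extra instruction is the subtraction from 0 that restores a wrong sign of the
  result.\<close>

lemma cells_imp_slp:
  assumes "f \<in> cells is"
  shows "\<exists>p. slp_cost p \<le> length is + 1 \<and> (\<forall>v\<in>D. slp_run p (inp v) = [f v])"
proof -
  let ?val = "\<lambda>v. operand_val (exec_instrs is (inp v))"
  obtain x where "(\<forall>v\<in>D. f v = ?val v x) \<or> (\<forall>v\<in>D. f v = - ?val v x)"
    using assms unfolding cells_def by blast
  then show ?thesis
  proof
    assume "\<forall>v\<in>D. f v = ?val v x"
    then show ?thesis
      by (intro exI[of _ "Slp is [x]"]) (auto simp: slp_cost_def slp_run_def)
  next
    assume "\<forall>v\<in>D. f v = - ?val v x"
    then show ?thesis
      by (intro exI[of _ "Slp (is @ [Sub (Const 0) x]) [Reg (n + length is)]"])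
        (auto simp: slp_cost_def slp_run_def exec_instrs_append length_exec_instrs length_inp nth_append)
  qed
qed

definition poly_cells :: "'a instr list \<Rightarrow> ('i \<Rightarrow> 'a poly) set" where
  "poly_cells is = {F. \<forall>k. (\<lambda>v. coeff (F v) k) \<in> cells is}"

lemma poly_cells_append: "poly_cells is \<subseteq> poly_cells (is @ js)"
  using cells_append by (auto simp: poly_cells_def)

lemma poly_cells_mult:
  fixes mul :: "'a slp"
  assumes mul: "multiplies_polys d mul"
    and F: "F \<in> poly_cells is" and G: "G \<in> poly_cells is"
    and dF: "\<And>v. v \<in> D \<Longrightarrow> degree (F v) \<le> d" and dG: "\<And>v. v \<in> D \<Longrightarrow> degree (G v) \<le> d"
  shows "\<exists>js. length js = slp_cost mul \<and> (\<lambda>v. F v * G v) \<in> poly_cells (is @ js)"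
proof -
  define fs where "fs = map (\<lambda>k v. coeff (F v) k) [0..<d + 1] @ map (\<lambda>k v. coeff (G v) k) [0..<d + 1]"
  have "set fs \<subseteq> cells is"
    using F G by (auto simp: fs_def poly_cells_def)
  then obtain js where js: "length js = slp_cost mul"
    "\<And>k. k < length (slp_outputs mul) \<Longrightarrow> (\<lambda>v. slp_run mul (map (\<lambda>f. f v) fs) ! k) \<in> cells (is @ js)"
    using cells_slp_run by blast
  have run: "slp_run mul (map (\<lambda>f. f v) fs) = map (coeff (F v * G v)) [0..<2 * d + 1]" if "v \<in> D" for v
    using mul dF[OF that] dG[OF that] unfolding multiplies_polys_def fs_def
    by (simp add: comp_def del: upt_Suc)
  \<comment> \<open>A run on zero polynomials reveals the number of outputs of \<open>mul\<close>,
    so that indexing them below \<open>2 * d + 1\<close> is legitimate.\<close>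
  have "slp_run mul (map (coeff 0) [0..<d + 1] @ map (coeff 0) [0..<d + 1]) = map (coeff 0) [0..<2 * d + 1]"
    using mul unfolding multiplies_polys_def
    by (metis degree_0 le0 mult_zero_left)
  then have outs: "length (slp_outputs mul) = 2 * d + 1"
    unfolding slp_run_def by (metis length_map length_upt minus_nat.diff_0)
  have "(\<lambda>v. coeff (F v * G v) k) \<in> cells (is @ js)" for k
  proof (cases "k < 2 * d + 1")
    case True
    show ?thesis
      by (rule cells_cong[OF js(2)[of k]]) (use True outs run in \<open>auto simp del: upt_Suc\<close>)
  next
    case False
    show ?thesis
    proof (rule cells_cong[OF cells_const[of 0]])
      fix v assume "v \<in> D"
      then have "degree (F v * G v) \<le> d + d"
        using degree_mult_le[of "F v" "G v"] dF dG by (meson add_mono order_trans)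
      then show "coeff (F v * G v) k = 0"
        using False by (intro coeff_eq_0) simp
    qed
  qed
  then show ?thesis
    using js(1) by (auto simp: poly_cells_def)
qed

end

section \<open>Bisection of rational generating functions\<close>

section \<open>Sections of polynomials and power series\<close>

unbundle fps_syntax

text \<open>For \<open>r\<close> = 0, 1 these are the even and odd parts: p(x) = p_0(x^2) + x
  p_1(x^2). The list is long enough, since the omitted coefficients lie beyond the degree of
  \<open>p\<close>.\<close>

definition poly_section :: "nat \<Rightarrow> 'a::comm_ring_1 poly \<Rightarrow> 'a poly" where
  "poly_section r p = Poly (map (\<lambda>k. coeff p (2 * k + r)) [0..<Suc (degree p)])"

lemma coeff_poly_section: "coeff (poly_section r p) k = coeff p (2 * k + r)"
  by (auto simp: poly_section_def nth_default_def coeff_eq_0 simp del: upt_Suc)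

abbreviation reflect :: "'a::comm_ring_1 poly \<Rightarrow> 'a poly" where
  "reflect q \<equiv> pcompose q [:0, - 1:]"

text \<open>Invariance under x -> -x would only give that twice the coefficient is 0, which is too
  weak in a general ring. Instead the terms for \<open>i\<close> and \<open>m - i\<close> cancel:
  their indices have different parity, hence their signs are opposite.\<close>

lemma odd_coeff_mult_reflect:
  fixes q :: "'a::comm_ring_1 poly"
  assumes "odd m"
  shows "coeff (q * reflect q) m = 0"
proof -
  let ?f = "\<lambda>i. coeff q i * ((- 1) ^ (m - i) * coeff q (m - i))"
  have split: "{..m} = {i\<in>{..m}. even i} \<union> {i\<in>{..m}. odd i}" by auto
  have "(\<Sum>i\<in>{i\<in>{..m}. odd i}. ?f i) = (\<Sum>i\<in>{i\<in>{..m}. even i}. ?f (m - i))"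
    by (rule sum.reindex_bij_witness[of _ "\<lambda>i. m - i" "\<lambda>i. m - i"]) (use assms in auto)
  also have "\<dots> = (\<Sum>i\<in>{i\<in>{..m}. even i}. - ?f i)"
    by (rule sum.cong) (use assms in \<open>auto simp: mult_ac\<close>)
  finally have "(\<Sum>i\<in>{i\<in>{..m}. even i}. ?f i) + (\<Sum>i\<in>{i\<in>{..m}. odd i}. ?f i) = 0"
    by (simp add: sum_negf)
  then have "(\<Sum>i\<le>m. ?f i) = 0"
    by (subst split, subst sum.union_disjoint) auto
  then show ?thesis
    by (simp add: coeff_mult coeff_pcompose_linear)
qed

text \<open>Multiplication by an even series commutes with taking sections, because only even
  indices \<open>i = 2 * j\<close> contribute to the convolution.\<close>

lemma fps_section_mult:
  fixes w u :: "nat \<Rightarrow> 'a::comm_ring_1"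
  assumes "\<And>m. odd m \<Longrightarrow> w m = 0" and "r < 2"
  shows "(Abs_fps w * Abs_fps u) $ (2 * k + r) =
    (Abs_fps (\<lambda>k. w (2 * k)) * Abs_fps (\<lambda>k. u (2 * k + r))) $ k"
proof -
  have "(\<Sum>i = 0..2 * k + r. w i * u (2 * k + r - i)) =
      (\<Sum>i\<in>(\<lambda>j. 2 * j) ` {0..k}. w i * u (2 * k + r - i))"
  proof (rule sum.mono_neutral_right)
    show "\<forall>i\<in>{0..2 * k + r} - (\<lambda>j. 2 * j) ` {0..k}. w i * u (2 * k + r - i) = 0"
    proof
      fix i assume i: "i \<in> {0..2 * k + r} - (\<lambda>j. 2 * j) ` {0..k}"
      \<comment> \<open>As \<open>r < 2\<close>, an even index up to \<open>2 * k + r\<close> is at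
        most \<open>2 * k\<close>, hence already in the image.\<close>
      have "odd i"
      proof
        assume "even i"
        then obtain j where "i = 2 * j" by blast
        with i assms(2) show False by auto
      qed
      then show "w i * u (2 * k + r - i) = 0" using assms(1) by simp
    qed
  qed auto
  also have "\<dots> = (\<Sum>j = 0..k. w (2 * j) * u (2 * k + r - 2 * j))"
    by (subst sum.reindex) (auto simp: inj_on_def)
  also have "\<dots> = (\<Sum>j = 0..k. w (2 * j) * u (2 * (k - j) + r))"
    by (rule sum.cong) (auto simp: diff_mult_distrib2)
  finally show ?thesis
    by (simp add: fps_mult_nth)
qed

text \<open>The identity u = P/Q, stated without division. The condition on \<open>P\<close> means
  degree below \<open>d\<close>, with P = 0 when \<open>d\<close> = 0.\<close>

definition rational_form ::
  "nat \<Rightarrow> 'a::comm_ring_1 poly \<Rightarrow> 'a poly \<Rightarrow> (nat \<Rightarrow> 'a) \<Rightarrow> bool" where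
  "rational_form d P Q u \<longleftrightarrow> (\<forall>k\<ge>d. coeff P k = 0) \<and> degree Q \<le> d \<and> coeff Q 0 = 1 \<and>
     fps_of_poly P = fps_of_poly Q * Abs_fps u"

lemma rational_form_nth_0: "rational_form d P Q u \<Longrightarrow> u 0 = coeff P 0"
  unfolding rational_form_def by (metis fps_mult_nth_0 fps_nth_Abs_fps fps_of_poly_nth mult_1)

lemma degree_reflect_le: "degree (reflect q) \<le> degree q"
  by (rule degree_le) (auto simp: coeff_pcompose_linear coeff_eq_0)

text \<open>Multiplying P = Q u by Q(-x) makes the factor of u even, so both sides can be sectioned.
  The products have degrees below 2d and at most 2d, and sectioning halves these bounds.\<close>

lemma rational_form_section:
  assumes rf: "rational_form d P Q u" and r: "r < 2"
  shows "rational_form d (poly_section r (P * reflect Q)) (poly_section 0 (Q * reflect Q))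
    (\<lambda>k. u (2 * k + r))"
proof -
  have P: "coeff P k = 0" if "k \<ge> d" for k
    using rf that by (simp add: rational_form_def)
  have Q: "degree Q \<le> d" "coeff Q 0 = 1" and PQ: "fps_of_poly P = fps_of_poly Q * Abs_fps u"
    using rf by (auto simp: rational_form_def)
  have Q': "degree (reflect Q) \<le> d"
    using degree_reflect_le Q(1) by (rule order_trans)
  \<comment> \<open>An index of at least 2d is not a sum of one below d and one at most d.\<close>
  have "coeff (P * reflect Q) (2 * k + r) = 0" if "k \<ge> d" for k
    unfolding coeff_mult
  proof (rule sum.neutral, rule ballI)
    fix i assume "i \<in> {..2 * k + r}"
    show "coeff P i * coeff (reflect Q) (2 * k + r - i) = 0"
    proof (cases "i \<ge> d")
      case False
      then have "degree (reflect Q) < 2 * k + r - i" using Q' that by simp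
      then show ?thesis by (simp add: coeff_eq_0)
    qed (simp add: P)
  qed
  moreover have "degree (poly_section 0 (Q * reflect Q)) \<le> d"
  proof (rule degree_le, intro allI impI)
    fix k assume "d < k"
    moreover have "degree (Q * reflect Q) \<le> d + d"
      using degree_mult_le[of Q "reflect Q"] Q(1) Q' by (meson add_mono order_trans)
    ultimately show "coeff (poly_section 0 (Q * reflect Q)) k = 0"
      by (simp add: coeff_poly_section coeff_eq_0)
  qed
  moreover have "coeff (Q * reflect Q) 0 = 1"
    using Q(2) by (simp flip: poly_0_coeff_0 add: poly_pcompose)
  moreover have "fps_of_poly (poly_section r (P * reflect Q)) =
    fps_of_poly (poly_section 0 (Q * reflect Q)) * Abs_fps (\<lambda>k. u (2 * k + r))"
  proof (rule fps_ext)
    fix k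
    have "fps_of_poly (P * reflect Q) = Abs_fps (coeff (Q * reflect Q)) * Abs_fps u"
      by (simp add: fps_of_poly_mult PQ mult_ac flip: fps_of_poly_def)
    then have "coeff (P * reflect Q) (2 * k + r) = (Abs_fps (coeff (Q * reflect Q)) * Abs_fps u) $ (2 * k + r)"
      by (metis fps_of_poly_nth)
    also have "\<dots> = (Abs_fps (\<lambda>k. coeff (Q * reflect Q) (2 * k)) * Abs_fps (\<lambda>k. u (2 * k + r))) $ k"
      using odd_coeff_mult_reflect r by (rule fps_section_mult)
    also have "Abs_fps (\<lambda>k. coeff (Q * reflect Q) (2 * k)) = fps_of_poly (poly_section 0 (Q * reflect Q))"
      by (simp add: fps_eq_iff coeff_poly_section)
    finally show "fps_of_poly (poly_section r (P * reflect Q)) $ k =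
        (fps_of_poly (poly_section 0 (Q * reflect Q)) * Abs_fps (\<lambda>k. u (2 * k + r))) $ k"
      by (simp add: coeff_poly_section)
  qed
  ultimately show ?thesis
    by (simp add: rational_form_def coeff_poly_section)
qed

text \<open>The reciprocal of the characteristic polynomial of the recurrence.\<close>

definition char_rev :: "nat \<Rightarrow> (nat \<Rightarrow> 'a::comm_ring_1) \<Rightarrow> 'a poly" where
  "char_rev d c = Poly (1 # map (\<lambda>k. - c (d - Suc k)) [0..<d])"

lemma coeff_char_rev:
  "coeff (char_rev d c) k = (if k = 0 then 1 else if k \<le> d then - c (d - k) else 0)"
  by (cases k) (auto simp: char_rev_def nth_default_def)

text \<open>Below \<open>d\<close> the coefficients of Q u involve only the initial terms; from
  \<open>d\<close> on they vanish by the recurrence.\<close>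

lemma rational_form_linear_recurrent:
  assumes "linear_recurrent d c u"
  shows "rational_form d (poly_cutoff d (char_rev d c * Poly (map u [0..<d]))) (char_rev d c) u"
proof -
  let ?Q = "char_rev d c"
  have "fps_of_poly (poly_cutoff d (?Q * Poly (map u [0..<d]))) $ k = (fps_of_poly ?Q * Abs_fps u) $ k" for k
  proof (cases "k < d")
    case True
    then have "nth_default 0 (map u [0..<d]) (k - i) = u (k - i)" for i
      by (simp add: nth_default_def)
    with True show ?thesis
      by (simp add: coeff_poly_cutoff coeff_mult fps_mult_nth atLeast0AtMost)
  next
    case False
    \<comment> \<open>With \<open>k = m + d\<close> the coefficient becomes the difference of the
      two sides of the recurrence at \<open>m\<close>.\<close>
    define m where "m = k - d"
    have k: "k = m + d" using False by (simp add: m_def)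
    have "(fps_of_poly ?Q * Abs_fps u) $ k = (\<Sum>i = 0..k. coeff ?Q i * u (k - i))"
      by (simp add: fps_mult_nth)
    also have "\<dots> = (\<Sum>i = 0..d. coeff ?Q i * u (k - i))"
      by (rule sum.mono_neutral_right) (auto simp: k coeff_char_rev)
    also have "\<dots> = u k + (\<Sum>i<d. - c (d - Suc i) * u (k - Suc i))"
      by (simp add: atLeast0AtMost sum.atMost_shift coeff_char_rev)
    also have "(\<Sum>i<d. - c (d - Suc i) * u (k - Suc i)) = (\<Sum>i<d. - (c i * u (m + i)))"
      by (rule sum.reindex_bij_witness[of _ "\<lambda>i. d - Suc i" "\<lambda>i. d - Suc i"])
        (auto simp: k intro!: arg_cong[of _ _ u])
    also have "u k + \<dots> = 0"
      using assms by (simp add: k linear_recurrent_def sum_negf)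
    finally show ?thesis
      using False by (simp add: coeff_poly_cutoff)
  qed
  then show ?thesis
    unfolding rational_form_def
    by (auto simp: fps_eq_iff coeff_poly_cutoff coeff_char_rev intro!: degree_le)
qed

section \<open>Halving the index and counting the products\<close>

section \<open>The algorithm\<close>

context program_inputs
begin

lemma poly_cells_section: "F \<in> poly_cells is \<Longrightarrow> (\<lambda>v. poly_section r (F v)) \<in> poly_cells is"
  by (simp add: poly_cells_def coeff_poly_section)

lemma poly_cells_reflect: "F \<in> poly_cells is \<Longrightarrow> (\<lambda>v. reflect (F v)) \<in> poly_cells is"
proof -
  assume F: "F \<in> poly_cells is"
  have "(\<lambda>v. (- 1) ^ k * coeff (F v) k) \<in> cells is" for k
    using F cells_uminus by (cases "even k") (auto simp: poly_cells_def)
  then show ?thesis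
    by (simp add: poly_cells_def coeff_pcompose_linear)
qed

text \<open>Induction on the number of halvings. Each costs two products, the final round one;
  sections only select coefficients and reflection only changes signs, so both are free.\<close>

lemma cells_rational_form_nth:
  fixes mul :: "'a slp"
  assumes mul: "multiplies_polys d mul"
    and "P \<in> poly_cells is" "Q \<in> poly_cells is"
    and "\<And>v. v \<in> D \<Longrightarrow> rational_form d (P v) (Q v) (u v)"
    and "N < 2 ^ Suc b"
  shows "\<exists>js. length js = (2 * b + 1) * slp_cost mul \<and> (\<lambda>v. u v N) \<in> cells (is @ js)"
  using assms(2-)
proof (induction b arbitrary: "is" P Q u N)
  case (0 "is" P Q u N)
  \<comment> \<open>Here \<open>N < 2\<close>, so \<open>N\<close> is its own last digit and the
    wanted term is the initial term of section \<open>N\<close>, which needs no new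
    denominator.\<close>
  let ?P = "\<lambda>v. poly_section N (P v * reflect (Q v))"
  have deg: "degree (P v) \<le> d" "degree (reflect (Q v)) \<le> d" if "v \<in> D" for v
    using 0(3)[OF that] degree_reflect_le[of "Q v"]
    by (auto simp: rational_form_def intro!: degree_le)
  obtain js where js: "length js = slp_cost mul"
    "(\<lambda>v. P v * reflect (Q v)) \<in> poly_cells (is @ js)"
    using poly_cells_mult[OF mul 0(1) poly_cells_reflect[OF 0(2)] deg] by blast
  have "(\<lambda>v. coeff (?P v) 0) \<in> cells (is @ js)"
    using poly_cells_section[OF js(2)] by (simp add: poly_cells_def)
  moreover have "u v N = coeff (?P v) 0" if "v \<in> D" for v
    using rational_form_nth_0[OF rational_form_section[OF 0(3)[OF that]], of N] 0(4) by simp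
  ultimately have "(\<lambda>v. u v N) \<in> cells (is @ js)"
    by (rule cells_cong)
  then show ?case using js(1) by auto
next
  case (Suc b "is" P Q u N)
  \<comment> \<open>The lowest binary digit selects the section, in which the wanted term has index
    \<open>N div 2\<close>.\<close>
  let ?r = "N mod 2"
  have deg: "degree (P v) \<le> d" "degree (Q v) \<le> d" "degree (reflect (Q v)) \<le> d" if "v \<in> D" for v
    using Suc(4)[OF that] degree_reflect_le[of "Q v"]
    by (auto simp: rational_form_def intro!: degree_le)
  obtain js where js: "length js = slp_cost mul"
    "(\<lambda>v. P v * reflect (Q v)) \<in> poly_cells (is @ js)"
    using poly_cells_mult[OF mul Suc(2) poly_cells_reflect[OF Suc(3)] deg(1,3)] by blast
  have Q: "Q \<in> poly_cells (is @ js)" using Suc(3) poly_cells_append by blast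
  obtain ks where ks: "length ks = slp_cost mul"
    "(\<lambda>v. Q v * reflect (Q v)) \<in> poly_cells ((is @ js) @ ks)"
    using poly_cells_mult[OF mul Q poly_cells_reflect[OF Q] deg(2,3)] by blast
  have js': "(\<lambda>v. P v * reflect (Q v)) \<in> poly_cells ((is @ js) @ ks)"
    using js(2) poly_cells_append by blast
  have rf: "rational_form d (poly_section ?r (P v * reflect (Q v))) (poly_section 0 (Q v * reflect (Q v)))
    (\<lambda>k. u v (2 * k + ?r))" if "v \<in> D" for v
    using rational_form_section[OF Suc(4)[OF that]] by simp
  have "N div 2 < 2 ^ Suc b" using Suc(5) by simp
  from Suc.IH[OF poly_cells_section[OF js'] poly_cells_section[OF ks(2)] rf this]
  obtain ls where "length ls = (2 * b + 1) * slp_cost mul"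
    "(\<lambda>v. u v (2 * (N div 2) + ?r)) \<in> cells (((is @ js) @ ks) @ ls)"
    by blast
  then show ?case
    using js(1) ks(1) by (intro exI[of _ "js @ ks @ ls"]) simp
qed

end

text \<open>Ensures that \<open>M d\<close> can pay for the final negation. Without instructions an
  output is a constant or a fixed input cell, holding a, b or 0 for constant polynomials a and b;
  values 0 and 1 show that none of these is ab.\<close>

lemma slp_cost_multiplies_polys_pos:
  fixes mul :: "'a::comm_ring_1 slp"
  assumes "multiplies_polys d mul"
  shows "slp_cost mul > 0"
proof (rule ccontr)
  assume "\<not> slp_cost mul > 0"
  then have empty: "slp_instrs mul = []" by (simp add: slp_cost_def)
  define inp :: "'a \<Rightarrow> 'a \<Rightarrow> 'a list" where
    "inp a b = map (coeff [:a:]) [0..<d + 1] @ map (coeff [:b:]) [0..<d + 1]" for a b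
  have run: "map (operand_val (inp a b)) (slp_outputs mul) = map (coeff [:a * b:]) [0..<2 * d + 1]" for a b
  proof -
    have "slp_run mul (inp a b) = map (coeff ([:a:] * [:b:])) [0..<2 * d + 1]"
      using assms unfolding multiplies_polys_def inp_def by (metis degree_pCons_0 le0)
    then show ?thesis by (simp add: slp_run_def empty mult.commute del: upt_Suc)
  qed
  from run[of 0 0] obtain x xs where outs: "slp_outputs mul = x # xs"
    by (cases "slp_outputs mul") (auto simp del: upt_Suc)
  have x: "operand_val (inp a b) x = a * b" for a b
    using arg_cong[OF run[of a b], of hd] by (simp add: outs hd_map del: upt_Suc)
  show False
  proof (cases x)
    case (Const e)
    then show ?thesis using x[of 0 0] x[of 1 1] by simp
  next
    case (Reg i)
    then show ?thesis
      using x[of 1 1] x[of 1 0] x[of 0 1]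
      by (auto simp: inp_def nth_append coeff_pCons split: if_splits nat.splits simp del: upt_Suc)
  qed
qed

text \<open>The ceiling bounds the number of binary digits of \<open>N\<close>; it is positive as
  \<open>N > 0\<close>, so the last round can be split off as the \<open>Suc\<close>.\<close>

lemma power_bounds_ceiling_log:
  assumes "N > 0"
  shows "\<exists>b. N < 2 ^ Suc b \<and> nat \<lceil>log 2 (real N + 1)\<rceil> = Suc b"
proof -
  define k where "k = nat \<lceil>log 2 (real N + 1)\<rceil>"
  have pos: "log 2 (real N + 1) > 0" using assms by simp
  then have "log 2 (real N + 1) \<le> real k" unfolding k_def by linarith
  then have "real N + 1 \<le> 2 ^ k" by (simp add: log_le_iff flip: powr_realpow)
  then have "N < 2 ^ k" by (metis Suc_le_eq of_nat_Suc of_nat_le_iff of_nat_numeral of_nat_power add.commute)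
  moreover obtain b where "k = Suc b" using pos by (cases k) (auto simp: k_def)
  ultimately show ?thesis unfolding k_def by auto
qed

theorem theorem1:
  fixes M :: "nat \<Rightarrow> nat" and d N :: nat and mul :: "'a::comm_ring_1 slp"
  assumes "d \<ge> 1" and "N > 0"
    and "multiplies_polys d mul" and "slp_cost mul = M d"
  shows "\<exists>p :: 'a slp. computes_term d N p \<and>
           slp_cost p \<le> 2 * M d * nat \<lceil>log 2 (real N + 1)\<rceil> + M d"
proof -
  define D :: "((nat \<Rightarrow> 'a) \<times> (nat \<Rightarrow> 'a)) set" where "D = {(c, u). linear_recurrent d c u}"
  define inp :: "(nat \<Rightarrow> 'a) \<times> (nat \<Rightarrow> 'a) \<Rightarrow> 'a list" where
    "inp v = map (fst v) [0..<d] @ map (snd v) [0..<d]" for v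
  interpret program_inputs D inp "2 * d"
    by unfold_locales (simp add: inp_def)
  let ?Q = "\<lambda>v. char_rev d (fst v)" and ?U = "\<lambda>v. Poly (map (snd v) [0..<d])"
  let ?P = "\<lambda>v. poly_cutoff d (?Q v * ?U v)"
  have c: "(\<lambda>v. fst v i) \<in> cells []" if "i < d" for i
    by (rule cellsI[where x = "Reg i"]) (use that in \<open>auto simp: inp_def nth_append\<close>)
  have u: "(\<lambda>v. snd v i) \<in> cells []" if "i < d" for i
    by (rule cellsI[where x = "Reg (d + i)"]) (use that in \<open>auto simp: inp_def nth_append\<close>)
  \<comment> \<open>The negated coefficients of \<open>?Q\<close> are input cells up to sign, so the
    denominator is available before any instruction.\<close>
  have Q: "(\<lambda>v. coeff (?Q v) k) \<in> cells []" for k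
    using cells_uminus[OF c[of "d - k"]] cells_const[of _ "[]"] assms(1)
    by (cases "k = 0"; cases "k \<le> d") (auto simp: coeff_char_rev)
  have U: "(\<lambda>v. coeff (?U v) k) \<in> cells []" for k
    using u[of k] cells_const[of _ "[]"] by (cases "k < d") (auto simp: nth_default_def)
  have QU: "?Q \<in> poly_cells []" "?U \<in> poly_cells []"
    using Q U by (simp_all add: poly_cells_def)
  have degQ: "degree (?Q v) \<le> d" for v
    by (rule degree_le) (simp add: coeff_char_rev)
  have degU: "degree (?U v) \<le> d" for v
    by (rule degree_le) (simp add: nth_default_def)
  obtain is0 where is0: "length is0 = M d" "(\<lambda>v. ?Q v * ?U v) \<in> poly_cells is0"
    using poly_cells_mult[OF assms(3) QU degQ degU] assms(4) by auto
  have P: "?P \<in> poly_cells is0"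
    unfolding poly_cells_def
  proof (intro CollectI allI)
    fix k
    show "(\<lambda>v. coeff (?P v) k) \<in> cells is0"
      using is0(2) cells_const by (cases "k < d") (auto simp: poly_cells_def coeff_poly_cutoff)
  qed
  have Q': "?Q \<in> poly_cells is0"
    using QU(1) poly_cells_append[of "[]" is0] by auto
  have rf: "rational_form d (?P v) (?Q v) (snd v)" if "v \<in> D" for v
    using that rational_form_linear_recurrent by (auto simp: D_def)
  obtain b where b: "N < 2 ^ Suc b" "nat \<lceil>log 2 (real N + 1)\<rceil> = Suc b"
    using power_bounds_ceiling_log[OF assms(2)] by blast
  obtain js where js: "length js = (2 * b + 1) * M d" "(\<lambda>v. snd v N) \<in> cells (is0 @ js)"
    using cells_rational_form_nth[OF assms(3) P Q' rf b(1)] assms(4) by auto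
  obtain p where p: "slp_cost p \<le> length (is0 @ js) + 1" "\<forall>v\<in>D. slp_run p (inp v) = [snd v N]"
    using cells_imp_slp[OF js(2)] by blast
  have "computes_term d N p"
    using p(2) by (auto simp: computes_term_def D_def inp_def)
  moreover have "M d \<ge> 1"
    using slp_cost_multiplies_polys_pos[OF assms(3)] assms(4) by simp
  \<comment> \<open>One product for the numerator, \<open>2 * b + 1\<close> for the rounds and one
    negation: in total \<open>2 * M d * Suc b + 1\<close>.\<close>
  then have "slp_cost p \<le> 2 * M d * Suc b + M d"
    using p(1) is0(1) js(1) by (simp add: algebra_simps)
  ultimately show ?thesis
    unfolding b(2) by blast
qed

end
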